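(* (i) For every even integer $w\ge0$, $W^{\mathrm{od}}_w\subseteq\mathrm{LSh}^{(2)}_w$. (ii) For every odd integer $w\ge1$, the $\mathbb Q$-linear map $\mathrm{FSh}^{\mathrm{pol}}_w\to\mathrm{LSh}^{(2)}_w$, $Q\mapsto Q\,|\,\gamma'(1-\varepsilon')\delta$, is well defined and bijective, with inverse $\mathrm{LSh}^{(2)}_w\to\mathrm{FSh}^{\mathrm{pol}}_w$, $P\mapsto-\frac13\,P\,|\,\gamma(1+\varepsilon)\delta$.
   Context: $V_w$ is the $\mathbb Q$-space of homogeneous polynomials of degree $w$ in $X,Y$. $\mathrm{GL}_2(\mathbb Z)$ acts on the right by $(P|A)(X,Y)=P(aX+bY,cX+dY)$ for $A=\begin{pmatrix}a&b\\c&d\end{pmatrix}$, extended linearly to the group ring $\mathbb Q[\mathrm{GL}_2(\mathbb Z)]$. Let $\varepsilon=\begin{pmatrix}0&1\\1&0\end{pmatrix}$, $\gamma=\begin{pmatrix}0&-1\\1&-1\end{pmatrix}$, $\delta=\begin{pmatrix}1&0\\0&-1\end{pmatrix}$, $\varepsilon'=\delta\varepsilon\delta=\begin{pmatrix}0&-1\\-1&0\end{pmatrix}$, $\gamma'=\delta\gamma\delta=\begin{pmatrix}0&1\\-1&-1\end{pmatrix}$. $\mathrm{LSh}^{(2)}_w=\{P\in V_w: P(X,X+Y)+P(Y,X+Y)=-P(X,-Y),\ P(X,Y)=P(-Y,-X)\}$. $W^{\mathrm{od}}_w=\{P\in V_w: P(X,Y)-P(X+Y,Y)-P(X+Y,X)=0\}$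 (odd period polynomials). $\mathrm{FSh}^{\mathrm{pol}}_w=\{Q\in V_w: Q(X,Y)+Q(Y,X)=0,\ Q(X,Y)+Q(X+Y,-Y)+Q(-X-Y,X)=0\}$ (polynomial part of the Fay-shuffle space). *)

theory Defs
  imports
    "HOL-Analysis.Analysis"
    "HOL-Computational_Algebra.Polynomial"
    "HOL-Library.Poly_Mapping"
begin

text \<open>
  Elements of \<open>\<rat>[X,Y]\<close> are represented as polynomials in \<open>Y\<close> whose coefficients are
  polynomials in \<open>X\<close>: the coefficient of \<open>X\<^sup>i Y\<^sup>j\<close> in \<open>P\<close> is \<open>coeff (coeff P j) i\<close>.
\<close>

type_synonym bipoly = "rat poly poly"

definition bX :: bipoly where "bX = [:[:0, 1:]:]"

definition bY :: bipoly where "bY = [:0, 1:]"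

definition qscale :: "rat \<Rightarrow> bipoly \<Rightarrow> bipoly" where
  "qscale c P = smult [:c:] P"

definition V :: "nat \<Rightarrow> bipoly set" where
  "V w = {P. \<forall>i j. coeff (coeff P j) i \<noteq> 0 \<longrightarrow> i + j = w}"

text \<open>\<open>subst2 P A B\<close> is \<open>P(A,B)\<close>, i.e. \<open>A\<close> is substituted for \<open>X\<close> and \<open>B\<close> for \<open>Y\<close>.\<close>

definition subst2 :: "bipoly \<Rightarrow> bipoly \<Rightarrow> bipoly \<Rightarrow> bipoly" where
  "subst2 P A B = poly (map_poly (\<lambda>p. poly (map_poly (\<lambda>c. [:[:c:]:]) p) A) P) B"

lemma subst2_altdef:
  "subst2 P A B =
     (\<Sum>j\<le>degree P. \<Sum>i\<le>degree (coeff P j). qscale (coeff (coeff P j) i) (A ^ i * B ^ j))"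
proof -
  have inner: "poly (map_poly (\<lambda>c. [:[:c:]:]) p) A = (\<Sum>i\<le>degree p. qscale (coeff p i) (A ^ i))"
    for p :: "rat poly"
  proof -
    have "degree (map_poly (\<lambda>c. [:[:c:]:]) p) = degree p"
      by (rule degree_map_poly) simp
    then show ?thesis
      by (simp add: poly_altdef coeff_map_poly qscale_def)
  qed
  let ?h = "\<lambda>p. poly (map_poly (\<lambda>c. [:[:c:]:]) p) A"
  have h0: "?h 0 = 0" by simp
  have "subst2 P A B = (\<Sum>j\<le>degree (map_poly ?h P). coeff (map_poly ?h P) j * B ^ j)"
    by (simp add: subst2_def poly_altdef)
  also have "\<dots> = (\<Sum>j\<le>degree P. coeff (map_poly ?h P) j * B ^ j)"
  proof (rule sum.mono_neutral_left)
    have "degree (map_poly ?h P) \<le> degree P"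
      by (rule degree_le) (simp add: coeff_map_poly coeff_eq_0)
    then show "{..degree (map_poly ?h P)} \<subseteq> {..degree P}" by simp
  qed (auto simp: coeff_eq_0 not_le)
  also have "\<dots> = (\<Sum>j\<le>degree P. ?h (coeff P j) * B ^ j)"
    by (simp add: coeff_map_poly)
  finally show ?thesis
    by (simp add: inner sum_distrib_right qscale_def)
qed

lemma vector_space_qscale: "vector_space qscale"
  by unfold_locales
    (simp_all add: qscale_def smult_add_right mult.commute flip: one_pCons smult_add_left)

text \<open>The group \<open>GL\<^sub>2(\<int>)\<close>; \<open>invertible\<close> means having a two-sided inverse with integer entries.\<close>

typedef gl2z = "{A :: int^2^2. invertible A}"
  by (auto intro!: exI[of _ "mat 1"] simp: invertible_def)

setup_lifting type_definition_gl2z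

instantiation gl2z :: monoid_mult
begin

lift_definition one_gl2z :: gl2z is "mat 1"
  by (auto simp: invertible_def)

lift_definition times_gl2z :: "gl2z \<Rightarrow> gl2z \<Rightarrow> gl2z" is "(**)"
  by (simp add: invertible_mult)

instance
  by standard (transfer; simp add: matrix_mul_assoc)+

end

lemma gl2z_left_inverse: "\<exists>B :: gl2z. B * A = 1"
  by transfer (auto simp: invertible_def)

abbreviation mat22 :: "int \<Rightarrow> int \<Rightarrow> int \<Rightarrow> int \<Rightarrow> int^2^2" where
  "mat22 a b c d \<equiv> vector [vector [a, b], vector [c, d]]"

lemma mat22_mult:
  "mat22 a b c d ** mat22 a' b' c' d' =
     mat22 (a * a' + b * c') (a * b' + b * d') (c * a' + d * c') (c * b' + d * d')"
  by (simp add: vec_eq_iff forall_2 matrix_matrix_mult_def sum_2)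

lemma mat22_one: "mat 1 = mat22 1 0 0 1"
  by (simp add: vec_eq_iff forall_2 mat_def)

lift_definition mat_eps :: gl2z is "mat22 0 1 1 0"
  unfolding invertible_def
  by (rule exI[of _ "mat22 0 1 1 0"]) (simp add: mat22_mult mat22_one)

lift_definition mat_gam :: gl2z is "mat22 0 (-1) 1 (-1)"
  unfolding invertible_def
  by (rule exI[of _ "mat22 (-1) 1 (-1) 0"]) (simp add: mat22_mult mat22_one)

lift_definition mat_del :: gl2z is "mat22 1 0 0 (-1)"
  unfolding invertible_def
  by (rule exI[of _ "mat22 1 0 0 (-1)"]) (simp add: mat22_mult mat22_one)

definition mat_eps' :: gl2z where "mat_eps' = mat_del * mat_eps * mat_del"

definition mat_gam' :: gl2z where "mat_gam' = mat_del * mat_gam * mat_del"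

lemma Rep_mat_eps': "Rep_gl2z mat_eps' = mat22 0 (-1) (-1) 0"
  by (simp add: mat_eps'_def times_gl2z.rep_eq mat_eps.rep_eq mat_del.rep_eq mat22_mult)

lemma Rep_mat_gam': "Rep_gl2z mat_gam' = mat22 0 1 (-1) (-1)"
  by (simp add: mat_gam'_def times_gl2z.rep_eq mat_gam.rep_eq mat_del.rep_eq mat22_mult)

text \<open>
  The group ring \<open>\<rat>[GL\<^sub>2(\<int>)]\<close> consists of the finitely supported functions from the group to
  \<open>\<rat>\<close>. The library product on \<open>\<Rightarrow>\<^sub>0\<close> convolves along an additive monoid of keys, so the
  convolution along the multiplicative group is defined here.
\<close>

type_synonym gring = "gl2z \<Rightarrow>\<^sub>0 rat"

definition gr :: "gl2z \<Rightarrow> gring" where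
  "gr A = Poly_Mapping.single A 1"

definition gr_mult :: "gring \<Rightarrow> gring \<Rightarrow> gring" (infixl \<open>\<star>\<close> 70) where
  "f \<star> g = (\<Sum>A\<in>Poly_Mapping.keys f. \<Sum>B\<in>Poly_Mapping.keys g.
      Poly_Mapping.single (A * B) (Poly_Mapping.lookup f A * Poly_Mapping.lookup g B))"

definition mat_act :: "bipoly \<Rightarrow> gl2z \<Rightarrow> bipoly" where
  "mat_act P A = (let M = Rep_gl2z A in
     subst2 P (of_int (M $ 1 $ 1) * bX + of_int (M $ 1 $ 2) * bY)
              (of_int (M $ 2 $ 1) * bX + of_int (M $ 2 $ 2) * bY))"

definition gr_act :: "bipoly \<Rightarrow> gring \<Rightarrow> bipoly" where
  "gr_act P f = (\<Sum>A\<in>Poly_Mapping.keys f. qscale (Poly_Mapping.lookup f A) (mat_act P A))"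

definition LSh2 :: "nat \<Rightarrow> bipoly set" where
  "LSh2 w = {P \<in> V w.
     subst2 P bX (bX + bY) + subst2 P bY (bX + bY) = - subst2 P bX (- bY) \<and>
     P = subst2 P (- bY) (- bX)}"

definition W_od :: "nat \<Rightarrow> bipoly set" where
  "W_od w = {P \<in> V w. P - subst2 P (bX + bY) bY - subst2 P (bX + bY) bX = 0}"

definition FSh_pol :: "nat \<Rightarrow> bipoly set" where
  "FSh_pol w = {Q \<in> V w.
     Q + subst2 Q bY bX = 0 \<and>
     Q + subst2 Q (bX + bY) (- bY) + subst2 Q (- bX - bY) bX = 0}"

definition qlinear_map :: "bipoly set \<Rightarrow> bipoly set \<Rightarrow> (bipoly \<Rightarrow> bipoly) \<Rightarrow> bool" where
  "qlinear_map S T f \<longleftrightarrow>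
     module.subspace qscale S \<and> module.subspace qscale T \<and> f \<in> S \<rightarrow> T \<and>
     (\<forall>P\<in>S. \<forall>Q\<in>S. f (P + Q) = f P + f Q) \<and>
     (\<forall>c. \<forall>P\<in>S. f (qscale c P) = qscale c (f P))"

end

theory Submission
  imports Defs
begin

text \<open>
  Substitution is compatible with composition, so each defining relation holds at all arguments.
  In odd degree the two maps become \<open>Q \<mapsto> Q(X,Y-X) - Q(Y,X-Y)\<close> and
  \<open>P \<mapsto> (P(X,X+Y) - P(Y,X+Y))/3\<close>, and every claim is a linear combination of a few
  instances of the relations.

  In even degree an odd period polynomial \<open>P\<close> is symmetric, and the inclusion amounts to
  \<open>S = 0\<close> for \<open>S(X,Y) = P(X,Y) + P(X,-Y)\<close>. The period relation makes \<open>S(X,Y)\<close> the average of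
  \<open>S(X+Y,Y)\<close> and \<open>S(X+Y,X)\<close>; since \<open>S\<close> is even in each variable this averaging can be inverted,
  which gives \<open>S(X,X+Y) = S(X,Y)\<close>. A symmetric translation invariant polynomial is constant.
\<close>

section \<open>Substitution\<close>

text \<open>The inner layer of \<open>subst2\<close>, split off so that each layer has its own
  \<open>pCons\<close> recursion and the homomorphism laws follow by polynomial induction.\<close>

definition subst1 :: "rat poly \<Rightarrow> bipoly \<Rightarrow> bipoly" where
  "subst1 p A = poly (map_poly (\<lambda>c. [:[:c:]:]) p) A"

lemma subst1_0 [simp]: "subst1 0 A = 0"
  by (simp add: subst1_def)

lemma subst1_pCons [simp]: "subst1 (pCons c p) A = [:[:c:]:] + A * subst1 p A"
  by (simp add: subst1_def map_poly_pCons)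

lemma subst2_0 [simp]: "subst2 0 A B = 0"
  by (simp add: subst2_def)

lemma subst2_pCons [simp]: "subst2 (pCons p P) A B = subst1 p A + B * subst2 P A B"
  by (simp add: subst2_def map_poly_pCons flip: subst1_def)

lemma subst1_add: "subst1 (p + q) A = subst1 p A + subst1 q A"
  by (induction p q rule: poly_induct2) (simp_all add: algebra_simps)

lemma subst1_smult: "subst1 (smult c p) A = [:[:c:]:] * subst1 p A"
  by (induction p) (simp_all add: algebra_simps)

lemma subst1_mult: "subst1 (p * q) A = subst1 p A * subst1 q A"
  by (induction p) (simp_all add: algebra_simps subst1_add subst1_smult)

lemma subst2_add: "subst2 (P + Q) A B = subst2 P A B + subst2 Q A B"
  by (induction P Q rule: poly_induct2) (simp_all add: algebra_simps subst1_add)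

lemma subst2_smult: "subst2 (smult p P) A B = subst1 p A * subst2 P A B"
  by (induction P) (simp_all add: algebra_simps subst1_mult)

lemma subst2_mult: "subst2 (P * Q) A B = subst2 P A B * subst2 Q A B"
  by (induction P) (simp_all add: algebra_simps subst2_add subst2_smult)

lemma subst2_qscale: "subst2 (qscale c P) A B = qscale c (subst2 P A B)"
  by (simp add: qscale_def subst2_smult)

lemma subst2_minus: "subst2 (- P) A B = - subst2 P A B"
  using subst2_add[of P "- P" A B] by (simp add: eq_neg_iff_add_eq_0 add.commute)

lemma subst2_diff: "subst2 (P - Q) A B = subst2 P A B - subst2 Q A B"
  using subst2_add[of P "- Q"] by (simp add: subst2_minus)

lemma subst1_1 [simp]: "subst1 1 A = 1"
  by (simp add: one_pCons)

lemma subst2_1 [simp]: "subst2 1 A B = 1"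
  using subst2_pCons[of 1 0 A B] by (simp flip: one_pCons)

lemma subst2_bX [simp]: "subst2 bX A B = A"
  by (simp add: bX_def flip: one_pCons)

lemma subst2_bY [simp]: "subst2 bY A B = B"
  by (simp add: bY_def flip: one_pCons)

lemma subst2_subst1: "subst2 (subst1 p A) C D = subst1 p (subst2 A C D)"
  by (induction p) (simp_all add: subst2_add subst2_mult)

text \<open>Substitution is a ring homomorphism fixing the rational constants, so a composite is
  determined by the images of \<open>A\<close> and \<open>B\<close>. This is what lets a polynomial
  identity be specialised to arbitrary arguments.\<close>

lemma subst2_subst2: "subst2 (subst2 P A B) C D = subst2 P (subst2 A C D) (subst2 B C D)"
  by (induction P) (simp_all add: subst2_add subst2_mult subst2_subst1)

lemma subst1_bX: "subst1 p bX = [:p:]"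
  by (induction p) (simp_all add: bX_def)

lemma subst2_bX_bY [simp]: "subst2 P bX bY = P"
  by (induction P) (simp_all add: bY_def subst1_bX)

lemmas subst2_hom = subst2_add subst2_diff subst2_minus subst2_subst2

lemma qscale_add: "qscale c (P + Q) = qscale c P + qscale c Q"
  by (simp add: qscale_def smult_add_right)

lemma qscale_diff: "qscale c (P - Q) = qscale c P - qscale c Q"
  by (simp add: qscale_def smult_diff_right)

text \<open>Clears the factor 3 that both compositions of the two maps produce.\<close>

lemma qscale_third: "qscale (1 / 3) (3 * P) = P"
  by (simp add: qscale_def numeral_poly flip: one_pCons)

section \<open>Homogeneous polynomials\<close>

lemma coeff2_mult:
  "coeff (coeff (P * Q :: bipoly) j) i =
     (\<Sum>l\<le>j. \<Sum>k\<le>i. coeff (coeff P l) k * coeff (coeff Q (j - l)) (i - k))"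
  by (simp add: coeff_mult coeff_sum)

lemma V_0: "0 \<in> V w"
  by (simp add: V_def)

lemma V_add: "P \<in> V w \<Longrightarrow> Q \<in> V w \<Longrightarrow> P + Q \<in> V w"
  by (clarsimp simp: V_def) (metis add_0)

lemma V_qscale: "P \<in> V w \<Longrightarrow> qscale c P \<in> V w"
  by (auto simp: V_def qscale_def)

lemma V_minus: "P \<in> V w \<Longrightarrow> - P \<in> V w"
  by (auto simp: V_def)

lemma V_diff: "P \<in> V w \<Longrightarrow> Q \<in> V w \<Longrightarrow> P - Q \<in> V w"
  using V_add[of P w "- Q"] V_minus by simp

lemma V_sum: "(\<And>x. x \<in> S \<Longrightarrow> f x \<in> V w) \<Longrightarrow> sum f S \<in> V w"
  by (induction S rule: infinite_finite_induct) (auto intro: V_0 V_add)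

text \<open>A nonzero coefficient of the product forces a nonzero term in the convolution, and the
  degrees of its two factors add up.\<close>

lemma V_mult:
  assumes "P \<in> V a" "Q \<in> V b"
  shows "P * Q \<in> V (a + b)"
  unfolding V_def
proof (clarify, rule ccontr)
  fix i j
  assume "coeff (coeff (P * Q) j) i \<noteq> 0" and ne: "i + j \<noteq> a + b"
  then obtain l k where "l \<le> j" "k \<le> i" "coeff (coeff P l) k \<noteq> 0"
      "coeff (coeff Q (j - l)) (i - k) \<noteq> 0"
    unfolding coeff2_mult
    by (metis (no_types, lifting) atMost_iff mult_eq_0_iff sum.not_neutral_contains_not_neutral)
  with assms have "k + l = a" "(i - k) + (j - l) = b"
    by (auto simp: V_def)
  with \<open>l \<le> j\<close> \<open>k \<le> i\<close> ne show False by linarith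
qed

lemma V_power: "P \<in> V 1 \<Longrightarrow> P ^ n \<in> V n"
proof (induction n)
  case 0
  show ?case by (auto simp: V_def coeff_pCons one_pCons split: nat.splits)
next
  case (Suc n)
  then show ?case using V_mult[of P 1 "P ^ n" n] by simp
qed

lemma V_bX: "bX \<in> V 1"
  by (auto simp: V_def bX_def coeff_pCons split: nat.splits)

lemma V_bY: "bY \<in> V 1"
  by (auto simp: V_def bY_def coeff_pCons one_pCons split: nat.splits)

lemma V_subst2:
  assumes "P \<in> V w" "A \<in> V 1" "B \<in> V 1"
  shows "subst2 P A B \<in> V w"
  unfolding subst2_altdef
proof (intro V_sum)
  fix i j
  show "qscale (coeff (coeff P j) i) (A ^ i * B ^ j) \<in> V w"
  proof (cases "coeff (coeff P j) i = 0")
    case True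
    then show ?thesis by (simp add: qscale_def V_0)
  next
    case False
    with assms(1) have "i + j = w" by (auto simp: V_def)
    with assms show ?thesis
      using V_mult[OF V_power V_power, of A B i j] by (auto intro: V_qscale)
  qed
qed

lemmas V_intros = V_add V_diff V_minus V_subst2 V_bX V_bY

text \<open>Each monomial picks up \<open>(- 1) ^ (i + j)\<close>, and homogeneity makes this one
  global sign. The parity of \<open>w\<close> enters the later arguments through it.\<close>

lemma subst2_neg:
  assumes "P \<in> V w"
  shows "subst2 P (- A) (- B) = (- 1) ^ w * subst2 P A B"
  unfolding subst2_altdef sum_distrib_left
proof (intro sum.cong refl)
  fix i j
  show "qscale (coeff (coeff P j) i) ((- A) ^ i * (- B) ^ j) =
        (- 1) ^ w * qscale (coeff (coeff P j) i) (A ^ i * B ^ j)"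
  proof (cases "coeff (coeff P j) i = 0")
    case True
    then show ?thesis by (simp add: qscale_def)
  next
    case False
    with assms have "w = i + j" by (auto simp: V_def)
    then show ?thesis
      by (simp add: qscale_def power_minus[of A] power_minus[of B] power_add algebra_simps)
  qed
qed

lemma subst2_neg_odd: "P \<in> V w \<Longrightarrow> odd w \<Longrightarrow> subst2 P (- A) (- B) = - subst2 P A B"
  by (simp add: subst2_neg)

lemma subst2_neg_even: "P \<in> V w \<Longrightarrow> even w \<Longrightarrow> subst2 P (- A) (- B) = subst2 P A B"
  by (simp add: subst2_neg)

section \<open>The defining relations at arbitrary arguments\<close>

text \<open>Substituting \<open>A\<close> and \<open>B\<close> into the defining identities gives
  one direction, the choice \<open>bX\<close>, \<open>bY\<close> the other.\<close>

lemma LSh2_iff: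
  "P \<in> LSh2 w \<longleftrightarrow> P \<in> V w \<and>
     (\<forall>A B. subst2 P A (A + B) + subst2 P B (A + B) = - subst2 P A (- B)) \<and>
     (\<forall>A B. subst2 P A B = subst2 P (- B) (- A))" (is "?L \<longleftrightarrow> ?R")
proof
  assume L: ?L
  then have 1: "subst2 P bX (bX + bY) + subst2 P bY (bX + bY) = - subst2 P bX (- bY)"
    and 2: "P = subst2 P (- bY) (- bX)" and 3: "P \<in> V w"
    by (auto simp: LSh2_def)
  have "subst2 P A (A + B) + subst2 P B (A + B) = - subst2 P A (- B)" for A B
    using arg_cong[OF 1, of "\<lambda>R. subst2 R A B"] by (simp add: subst2_hom)
  moreover have "subst2 P A B = subst2 P (- B) (- A)" for A B
    using arg_cong[OF 2, of "\<lambda>R. subst2 R A B"] by (simp add: subst2_hom)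
  ultimately show ?R using 3 by blast
next
  assume R: ?R
  then have "P \<in> V w" "subst2 P bX bY = subst2 P (- bY) (- bX)"
    "subst2 P bX (bX + bY) + subst2 P bY (bX + bY) = - subst2 P bX (- bY)" by blast+
  then show ?L by (simp add: LSh2_def)
qed

lemma FSh_pol_iff:
  "Q \<in> FSh_pol w \<longleftrightarrow> Q \<in> V w \<and>
     (\<forall>A B. subst2 Q B A = - subst2 Q A B) \<and>
     (\<forall>A B. subst2 Q A B + subst2 Q (A + B) (- B) + subst2 Q (- A - B) A = 0)"
  (is "?L \<longleftrightarrow> ?R")
proof
  assume L: ?L
  then have 1: "Q + subst2 Q bY bX = 0" and 3: "Q \<in> V w"
    and 2: "Q + subst2 Q (bX + bY) (- bY) + subst2 Q (- bX - bY) bX = 0"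
    by (auto simp: FSh_pol_def)
  have "subst2 Q B A = - subst2 Q A B" for A B
    using arg_cong[OF 1, of "\<lambda>R. subst2 R A B"]
    by (simp add: subst2_hom add_eq_0_iff)
  moreover have "subst2 Q A B + subst2 Q (A + B) (- B) + subst2 Q (- A - B) A = 0" for A B
    using arg_cong[OF 2, of "\<lambda>R. subst2 R A B"] by (simp add: subst2_hom)
  ultimately show ?R using 3 by blast
next
  assume R: ?R
  then have "Q \<in> V w" "subst2 Q bY bX = - subst2 Q bX bY"
    "subst2 Q bX bY + subst2 Q (bX + bY) (- bY) + subst2 Q (- bX - bY) bX = 0" by blast+
  then show ?L by (simp add: FSh_pol_def)
qed

lemma W_odD:
  assumes "P \<in> W_od w"
  shows "P \<in> V w" "subst2 P A B = subst2 P (A + B) B + subst2 P (A + B) A"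
proof -
  from assms have 1: "P - subst2 P (bX + bY) bY - subst2 P (bX + bY) bX = 0" and "P \<in> V w"
    by (auto simp: W_od_def)
  then show "P \<in> V w" by simp
  show "subst2 P A B = subst2 P (A + B) B + subst2 P (A + B) A"
    using arg_cong[OF 1, of "\<lambda>R. subst2 R A B"] by (simp add: subst2_hom algebra_simps)
qed

section \<open>Linear subspaces cut out by the relations\<close>

interpretation qscale: vector_space qscale
  by (rule vector_space_qscale)

lemma subspace_LSh2: "qscale.subspace (LSh2 w)"
proof (rule qscale.subspaceI)
  show "0 \<in> LSh2 w" by (simp add: LSh2_iff V_0)
next
  fix P Q assume "P \<in> LSh2 w" "Q \<in> LSh2 w"
  then show "P + Q \<in> LSh2 w"
    unfolding LSh2_iff subst2_add
  proof (intro conjI allI; elim conjE)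
    fix A B
    assume P: "\<forall>A B. subst2 P A (A + B) + subst2 P B (A + B) = - subst2 P A (- B)"
      and Q: "\<forall>A B. subst2 Q A (A + B) + subst2 Q B (A + B) = - subst2 Q A (- B)"
    have "(subst2 P A (A + B) + subst2 P B (A + B)) + (subst2 Q A (A + B) + subst2 Q B (A + B)) =
        - subst2 P A (- B) + - subst2 Q A (- B)"
      by (simp only: P Q)
    then show "subst2 P A (A + B) + subst2 Q A (A + B) + (subst2 P B (A + B) + subst2 Q B (A + B)) =
        - (subst2 P A (- B) + subst2 Q A (- B))"
      by (simp add: add_ac)
  qed (auto intro: V_add)
next
  fix c P assume "P \<in> LSh2 w"
  then show "qscale c P \<in> LSh2 w"
    unfolding LSh2_iff subst2_qscale qscale_add[symmetric] qscale.scale_minus_right[symmetric]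
    by (metis V_qscale qscale.scale_zero_right)
qed

lemma subspace_FSh_pol: "qscale.subspace (FSh_pol w)"
proof (rule qscale.subspaceI)
  show "0 \<in> FSh_pol w" by (simp add: FSh_pol_iff V_0)
next
  fix P Q assume "P \<in> FSh_pol w" "Q \<in> FSh_pol w"
  then have V: "P \<in> V w" "Q \<in> V w"
    and anti: "\<And>A B. subst2 P B A = - subst2 P A B" "\<And>A B. subst2 Q B A = - subst2 Q A B"
    and rel: "\<And>A B. subst2 P A B + subst2 P (A + B) (- B) + subst2 P (- A - B) A = 0"
      "\<And>A B. subst2 Q A B + subst2 Q (A + B) (- B) + subst2 Q (- A - B) A = 0"
    unfolding FSh_pol_iff by blast+
  show "P + Q \<in> FSh_pol w"
    unfolding FSh_pol_iff subst2_add
  proof (intro conjI allI V_add V)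
    fix A B
    show "subst2 P B A + subst2 Q B A = - (subst2 P A B + subst2 Q A B)"
      using anti(1)[of A B] anti(2)[of A B] by simp
    have "(subst2 P A B + subst2 P (A + B) (- B) + subst2 P (- A - B) A) +
        (subst2 Q A B + subst2 Q (A + B) (- B) + subst2 Q (- A - B) A) = 0"
      by (simp only: rel add_0)
    then show "subst2 P A B + subst2 Q A B + (subst2 P (A + B) (- B) + subst2 Q (A + B) (- B)) +
        (subst2 P (- A - B) A + subst2 Q (- A - B) A) = 0"
      by (simp add: add_ac)
  qed
next
  fix c P assume "P \<in> FSh_pol w"
  then have V: "P \<in> V w" and anti: "\<And>A B. subst2 P B A = - subst2 P A B"
    and rel: "\<And>A B. subst2 P A B + subst2 P (A + B) (- B) + subst2 P (- A - B) A = 0"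
    unfolding FSh_pol_iff by blast+
  show "qscale c P \<in> FSh_pol w"
    unfolding FSh_pol_iff subst2_qscale qscale_add[symmetric] qscale.scale_minus_right[symmetric]
      rel anti[symmetric]
    by (simp add: V V_qscale)
qed

section \<open>The group ring action\<close>

text \<open>Terms outside the supports vanish. A common finite index set is what additivity needs,
  since the support of a sum can shrink by cancellation.\<close>

lemma gr_mult_superset:
  assumes "finite S" "finite T" "Poly_Mapping.keys f \<subseteq> S" "Poly_Mapping.keys g \<subseteq> T"
  shows "f \<star> g = (\<Sum>A\<in>S. \<Sum>B\<in>T. Poly_Mapping.single (A * B)
      (Poly_Mapping.lookup f A * Poly_Mapping.lookup g B))"
proof -
  have "f \<star> g = (\<Sum>A\<in>Poly_Mapping.keys f. \<Sum>B\<in>T. Poly_Mapping.single (A * B)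
      (Poly_Mapping.lookup f A * Poly_Mapping.lookup g B))"
    unfolding gr_mult_def using assms
    by (intro sum.cong refl sum.mono_neutral_left) (auto simp: in_keys_iff)
  also have "\<dots> = (\<Sum>A\<in>S. \<Sum>B\<in>T. Poly_Mapping.single (A * B)
      (Poly_Mapping.lookup f A * Poly_Mapping.lookup g B))"
    using assms by (intro sum.mono_neutral_left) (auto simp: in_keys_iff)
  finally show ?thesis .
qed

lemma gr_act_superset:
  assumes "finite S" "Poly_Mapping.keys f \<subseteq> S"
  shows "gr_act P f = (\<Sum>A\<in>S. qscale (Poly_Mapping.lookup f A) (mat_act P A))"
  unfolding gr_act_def using assms
  by (intro sum.mono_neutral_left) (auto simp: in_keys_iff)

lemma gr_mult_gr_gr: "gr A \<star> gr B = gr (A * B)"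
  by (simp add: gr_mult_def gr_def)

lemma gr_mult_add_right: "f \<star> (g + h) = f \<star> g + f \<star> h"
proof -
  let ?T = "Poly_Mapping.keys g \<union> Poly_Mapping.keys h"
  have "Poly_Mapping.keys (g + h) \<subseteq> ?T" by (rule keys_add)
  then show ?thesis
    by (simp add: gr_mult_superset[of "Poly_Mapping.keys f" ?T] lookup_add distrib_left
        single_add sum.distrib)
qed

lemma gr_mult_add_left: "(g + h) \<star> f = g \<star> f + h \<star> f"
proof -
  let ?T = "Poly_Mapping.keys g \<union> Poly_Mapping.keys h"
  have "Poly_Mapping.keys (g + h) \<subseteq> ?T" by (rule keys_add)
  then show ?thesis
    by (simp add: gr_mult_superset[of ?T "Poly_Mapping.keys f"] lookup_add distrib_right
        single_add sum.distrib)
qed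

lemma gr_mult_diff_right: "f \<star> (g - h) = f \<star> g - f \<star> h"
  using gr_mult_add_right[of f "g - h" h] by simp

lemma gr_mult_diff_left: "(g - h) \<star> f = g \<star> f - h \<star> f"
  using gr_mult_add_left[of "g - h" h f] by simp

lemma gr_act_gr: "gr_act P (gr A) = mat_act P A"
  by (simp add: gr_act_def gr_def)

lemma gr_act_add: "gr_act P (f + g) = gr_act P f + gr_act P g"
proof -
  let ?T = "Poly_Mapping.keys f \<union> Poly_Mapping.keys g"
  have "Poly_Mapping.keys (f + g) \<subseteq> ?T" by (rule keys_add)
  then show ?thesis
    by (simp add: gr_act_superset[of ?T] lookup_add qscale.scale_left_distrib sum.distrib)
qed

lemma gr_act_diff: "gr_act P (f - g) = gr_act P f - gr_act P g"
  using gr_act_add[of P "f - g" g] by simp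

lemmas gr_simps = gr_mult_gr_gr gr_mult_add_right gr_mult_add_left gr_mult_diff_right
  gr_mult_diff_left gr_act_gr gr_act_add gr_act_diff

lemmas mat_simps = mat_act_def times_gl2z.rep_eq one_gl2z.rep_eq Rep_mat_eps' Rep_mat_gam'
  mat_eps.rep_eq mat_gam.rep_eq mat_del.rep_eq mat22_mult mat22_one

text \<open>The two matrices that occur are \<open>mat_gam' * mat_del\<close>, with rows (0,-1) and
  (-1,1), and \<open>mat_gam' * mat_eps' * mat_del\<close>, with rows (-1,0) and (1,-1).\<close>

lemma gr_act_phi:
  "gr_act Q (gr mat_gam' \<star> (gr 1 - gr mat_eps') \<star> gr mat_del) =
     subst2 Q (- bY) (bY - bX) - subst2 Q (- bX) (bX - bY)"
  by (simp add: gr_simps mat_simps)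

lemma gr_act_psi:
  "gr_act P (gr mat_gam \<star> (gr 1 + gr mat_eps) \<star> gr mat_del) =
     subst2 P bY (bX + bY) + subst2 P (- bX) (- bX - bY)"
  by (simp add: gr_simps mat_simps)

section \<open>Odd period polynomials of even degree\<close>

text \<open>As a polynomial in Y over Q[X], \<open>S\<close> takes the same value at every multiple
  nX, hence is constant in Y. Symmetry makes it constant in X as well, and positive degree leaves
  only 0.\<close>

lemma translation_invariant_symmetric_eq_0:
  assumes V: "S \<in> V w" and w: "w > 0"
    and tr: "\<And>A B. subst2 S A (A + B) = subst2 S A B"
    and sym: "subst2 S bY bX = S"
  shows "S = 0"
proof -
  \<comment> \<open>Evaluating the outer polynomial at \<open>c\<close> in Q[X] is the substitution
    that keeps X; \<open>[:0, 1:]\<close> below is X in the coefficient ring.\<close>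
  have sb: "subst2 R bX [:c:] = [:poly R c:]" for R :: bipoly and c
    by (induction R) (simp_all add: subst1_bX)
  have root: "poly S (of_nat n * [:0, 1:]) = poly S 0" for n
  proof (induction n)
    case (Suc n)
    have "[:poly S (of_nat (Suc n) * [:0, 1:]):] = subst2 S bX (bX + [:of_nat n * [:0, 1:]:])"
      by (simp add: bX_def algebra_simps flip: sb)
    also have "\<dots> = [:poly S (of_nat n * [:0, 1:]):]"
      by (simp add: tr sb)
    finally show ?case using Suc by simp
  qed simp
  define R where "R = S - [:poly S 0:]"
  have "R = 0"
  proof (rule ccontr)
    assume "R \<noteq> 0"
    then have "finite {x. poly R x = 0}" by (rule poly_roots_finite)
    moreover have "range (\<lambda>n. of_nat n * [:0, 1:]) \<subseteq> {x. poly R x = 0}"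
      using root by (auto simp: R_def)
    moreover have "inj (\<lambda>n :: nat. of_nat n * [:0, 1 :: rat:])"
      by (rule injI) (simp del: mult_pCons_right)
    ultimately show False
      using finite_subset range_inj_infinite by blast
  qed
  then obtain c where c: "S = [:c:]" by (metis R_def eq_iff_diff_eq_0)
  \<comment> \<open>Replacing X by Y moves the coefficients of \<open>p\<close> to the outer layer,
    so comparing the coefficients of Y^0 in the symmetry relation shows that \<open>c\<close> is
    constant.\<close>
  have swap: "coeff (subst1 p bY) j = [:coeff p j:]" for p j
    by (induction p arbitrary: j) (auto simp: bY_def coeff_pCons split: nat.splits)
  from sym have "S = subst1 c bY" by (simp add: c)
  then have "coeff S 0 = [:coeff c 0:]" by (simp add: swap)
  then have "c = [:coeff c 0:]" by (simp add: c)
  moreover have "coeff c 0 = 0"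
    using V w by (auto simp: V_def c dest!: spec[of _ 0])
  ultimately show ?thesis by (simp add: c)
qed

lemma W_od_subset_LSh2:
  assumes "even w"
  shows "W_od w \<subseteq> LSh2 w"
proof
  fix P assume P: "P \<in> W_od w"
  note V = W_odD(1)[OF P] and rel = W_odD(2)[OF P]
  note ev = subst2_neg_even[OF V \<open>even w\<close>]
  \<comment> \<open>The right side of the period relation is symmetric in \<open>A\<close> and
    \<open>B\<close>.\<close>
  have sym: "subst2 P A B = subst2 P B A" for A B
    using rel[of A B] rel[of B A] by (simp add: add.commute)
  define s where "s A B = subst2 P A B + subst2 P A (- B)" for A B
  have s_sym: "s A B = s B A" for A B
    using sym[of A B] ev[of A "- B"] sym[of "- A" B] by (simp add: s_def)
  have s_neg: "s A (- B) = s A B" for A B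
    by (simp add: s_def)
  \<comment> \<open>The period relation at (A+B,-B) and (A+B,-A) expands the terms with a negated
    argument. By symmetry the leftover P(A,A+B) + P(B,A+B) is again P(A,B).\<close>
  have s_rel: "s (A + B) B + s (A + B) A = s A B + s A B" for A B
  proof -
    have "subst2 P (A + B) (- B) = subst2 P A (- B) + subst2 P A (A + B)"
      using rel[of "A + B" "- B"] by simp
    moreover have "subst2 P (A + B) (- A) = subst2 P B (- A) + subst2 P B (A + B)"
      using rel[of "A + B" "- A"] by simp
    moreover have "subst2 P B (- A) = subst2 P A (- B)"
      using sym[of B "- A"] ev[of "A" "- B"] by simp
    ultimately show ?thesis
      using rel[of A B] sym[of A "A + B"] sym[of B "A + B"] by (simp add: s_def)
  qed
  \<comment> \<open>Replacing \<open>(A, B)\<close> by \<open>(A + B, - B)\<close> in the relation inverts the averaging.\<close>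
  have s_inv: "s A B + s A (A + B) = s (A + B) B + s (A + B) B" for A B
    using s_rel[of "A + B" "- B"] by (simp add: s_neg)
  have s_tr: "s A (A + B) = s A B" for A B
  proof -
    \<comment> \<open>Put t = s(A,B), u = s(A,A+B), v = s(B,A+B). Then u + v = 2t and t + u = 2v;
      eliminating v gives 3u = 3t.\<close>
    have "3 * s A (A + B) = 3 * s A B"
      using s_rel[of A B] s_inv[of A B] s_inv[of B A]
        s_sym[of A B] s_sym[of A "A + B"] s_sym[of B "A + B"]
      by (simp add: add.commute)
    then show ?thesis by simp
  qed
  define S where "S = s bX bY"
  have sS: "subst2 S A B = s A B" for A B
    by (simp add: S_def s_def subst2_hom)
  have s0: "s A B = 0" for A B
  proof (cases "w = 0")
    case False
    have "S \<in> V w" using V by (auto simp: S_def s_def intro!: V_intros)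
    moreover have "subst2 S bY bX = S"
      using s_sym[of bX bY] by (simp only: sS) (simp only: S_def)
    ultimately have "S = 0"
      using False s_tr by (intro translation_invariant_symmetric_eq_0) (auto simp: sS)
    then show ?thesis using sS[of A B] by simp
  next
    \<comment> \<open>Nonzero constants are translation invariant, so degree 0 is settled directly:
      the period relation at (0,0) reads c = c + c.\<close>
    case True
    have "P = [:[:coeff (coeff P 0) 0:]:]"
    proof (intro poly_eqI)
      fix i j
      show "coeff (coeff P j) i = coeff (coeff [:[:coeff (coeff P 0) 0:]:] j) i"
        using V True by (auto simp: V_def coeff_pCons split: nat.splits)
    qed
    then obtain c where c: "P = [:[:c:]:]" by blast
    from rel[of 0 0] show ?thesis by (simp add: s_def c)
  qed
  show "P \<in> LSh2 w"
    unfolding LSh2_iff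
  proof (intro conjI allI V)
    fix A B
    show "subst2 P A B = subst2 P (- B) (- A)"
      using sym[of A B] ev[of B A] by simp
    \<comment> \<open>The left side is P(A,B) by the period relation and symmetry, and
      \<open>s0\<close> gives P(A,B) = -P(A,-B).\<close>
    show "subst2 P A (A + B) + subst2 P B (A + B) = - subst2 P A (- B)"
      using s0[of A B] rel[of A B] sym[of A "A + B"] sym[of B "A + B"]
      by (simp add: s_def algebra_simps eq_neg_iff_add_eq_0)
  qed
qed

section \<open>The isomorphism in odd degree\<close>

definition phi :: "bipoly \<Rightarrow> bipoly" where
  "phi Q = subst2 Q (- bY) (bY - bX) - subst2 Q (- bX) (bX - bY)"

definition psi :: "bipoly \<Rightarrow> bipoly" where
  "psi P = qscale (- 1 / 3) (subst2 P bY (bX + bY) + subst2 P (- bX) (- bX - bY))"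

text \<open>Odd degree turns Q(-B,B-A) into -Q(B,A-B), which makes the antisymmetry of the image
  visible.\<close>

lemma subst2_phi:
  assumes "Q \<in> V w" "odd w"
  shows "subst2 (phi Q) A B = subst2 Q A (B - A) - subst2 Q B (A - B)"
  using subst2_neg_odd[OF assms, of A "B - A"] subst2_neg_odd[OF assms, of B "A - B"]
  by (simp add: phi_def subst2_hom)

lemma subst2_psi:
  assumes "P \<in> V w" "odd w"
  shows "subst2 (psi P) A B = qscale (1 / 3) (subst2 P A (A + B) - subst2 P B (A + B))"
  using subst2_neg_odd[OF assms, of A "A + B"]
  by (simp add: psi_def subst2_hom subst2_qscale qscale_diff)

lemma phi_mem:
  assumes Q: "Q \<in> FSh_pol w" and w: "odd w"
  shows "phi Q \<in> LSh2 w"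
proof -
  have V: "Q \<in> V w" and anti: "\<And>A B. subst2 Q B A = - subst2 Q A B"
    using Q unfolding FSh_pol_iff by blast+
  note phi = subst2_phi[OF V w] and neg = subst2_neg_odd[OF V w]
  show ?thesis
    unfolding LSh2_iff
  proof (intro conjI allI)
    show "phi Q \<in> V w" using V by (auto simp: phi_def intro!: V_intros)
    fix A B
    show "subst2 (phi Q) A B = subst2 (phi Q) (- B) (- A)"
      using neg[of A "B - A"] neg[of B "A - B"] by (simp add: phi)
    \<comment> \<open>Q(A,B) and Q(B,A) cancel on the left; both sides then equal -Q(A+B,-A) -
      Q(A+B,-B).\<close>
    show "subst2 (phi Q) A (A + B) + subst2 (phi Q) B (A + B) = - subst2 (phi Q) A (- B)"
      using neg[of A "- B - A"] anti[of A B] anti[of "A + B" "- A"] anti[of "A + B" "- B"]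
      by (simp add: phi)
  qed
qed

lemma psi_mem:
  assumes P: "P \<in> LSh2 w" and w: "odd w"
  shows "psi P \<in> FSh_pol w"
proof -
  have V: "P \<in> V w" and sym: "\<And>A B. subst2 P A B = subst2 P (- B) (- A)"
    using P unfolding LSh2_iff by blast+
  note psi = subst2_psi[OF V w] and neg = subst2_neg_odd[OF V w]
  \<comment> \<open>In odd degree, invariance under (A,B) -> (-B,-A) is the same as
    antisymmetry.\<close>
  have anti: "subst2 P B A = - subst2 P A B" for A B
    using sym[of B A] neg[of A B] by simp
  show ?thesis
    unfolding FSh_pol_iff
  proof (intro conjI allI)
    show "psi P \<in> V w" using V by (auto simp: psi_def intro!: V_qscale V_intros)
    fix A B
    show "subst2 (psi P) B A = - subst2 (psi P) A B"
      by (simp add: psi add.commute flip: qscale.scale_minus_right)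
    have "subst2 P (- A - B) (- B) = - subst2 P (A + B) B"
      using neg[of "A + B" B] by simp
    \<comment> \<open>The six values of P cancel in three pairs, by antisymmetry and odd
      degree.\<close>
    then show "subst2 (psi P) A B + subst2 (psi P) (A + B) (- B) + subst2 (psi P) (- A - B) A = 0"
      using anti[of A "A + B"] anti[of B "A + B"] anti[of A "- B"] neg[of A "- B"]
      by (simp add: psi flip: qscale_add)
  qed
qed

lemma psi_phi:
  assumes Q: "Q \<in> FSh_pol w" and w: "odd w"
  shows "psi (phi Q) = Q"
proof -
  have V: "Q \<in> V w" and anti: "\<And>A B. subst2 Q B A = - subst2 Q A B"
    and rel: "\<And>A B. subst2 Q A B + subst2 Q (A + B) (- B) + subst2 Q (- A - B) A = 0"
    using Q unfolding FSh_pol_iff by blast+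
  have V': "phi Q \<in> V w" using phi_mem[OF assms] unfolding LSh2_iff by blast
  \<comment> \<open>Antisymmetry supplies two copies of Q. The remaining terms Q(X+Y,-X) - Q(X+Y,-Y)
    are the third, by the three-term relation.\<close>
  have "subst2 (phi Q) bX (bX + bY) - subst2 (phi Q) bY (bX + bY) = 3 * Q"
    using rel[of bX bY] anti[of bX bY] subst2_neg_odd[OF V w, of "bX + bY" "- bX"]
    by (simp add: subst2_phi[OF V w] algebra_simps)
  then have "subst2 (psi (phi Q)) bX bY = qscale (1 / 3) (3 * Q)"
    by (simp only: subst2_psi[OF V' w])
  then show ?thesis by (simp add: qscale_third)
qed

lemma phi_psi:
  assumes P: "P \<in> LSh2 w" and w: "odd w"
  shows "phi (psi P) = P"
proof -
  have V: "P \<in> V w" and sym: "\<And>A B. subst2 P A B = subst2 P (- B) (- A)"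
    and rel: "\<And>A B. subst2 P A (A + B) + subst2 P B (A + B) = - subst2 P A (- B)"
    using P unfolding LSh2_iff by blast+
  have anti: "subst2 P B A = - subst2 P A B" for A B
    using sym[of B A] subst2_neg_odd[OF V w, of A B] by simp
  have V': "psi P \<in> V w" using psi_mem[OF assms] unfolding FSh_pol_iff by blast
  \<comment> \<open>The relation at (Y,X-Y) and antisymmetry give P(X-Y,X) = P(X,Y) + P(Y-X,Y), so
    the terms P(Y-X,Y) cancel.\<close>
  have "(subst2 P bX bY - subst2 P (bY - bX) bY) - (subst2 P bY bX - subst2 P (bX - bY) bX)
      = 3 * P"
    using rel[of bY "bX - bY"] anti[of bX bY] anti[of "bY - bX" bY]
    by simp
  then have "subst2 (phi (psi P)) bX bY = qscale (1 / 3) (3 * P)"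
    by (simp only: subst2_phi[OF V' w] subst2_psi[OF V w] qscale_diff[symmetric]
        add_diff_cancel_left' diff_add_cancel add_diff_eq)
  then show ?thesis by (simp add: qscale_third)
qed

section \<open>Linearity of the two maps and conclusion\<close>

lemma phi_add: "phi (P + Q) = phi P + phi Q"
  by (simp add: phi_def subst2_add)

lemma phi_qscale: "phi (qscale c P) = qscale c (phi P)"
  by (simp add: phi_def subst2_qscale qscale_diff)

lemma psi_add: "psi (P + Q) = psi P + psi Q"
  by (simp add: psi_def subst2_add qscale_add)

lemma psi_qscale: "psi (qscale c P) = qscale c (psi P)"
  by (simp add: psi_def subst2_qscale qscale_add qscale_diff mult.commute)

theorem theorem1p3:
  shows "(\<forall>w :: nat. even w \<longrightarrow> W_od w \<subseteq> LSh2 w) \<and>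
    (\<forall>w :: nat. odd w \<longrightarrow>
      (let \<phi> = (\<lambda>Q. gr_act Q (gr mat_gam' \<star> (gr 1 - gr mat_eps') \<star> gr mat_del));
           \<psi> = (\<lambda>P. qscale (- 1 / 3) (gr_act P (gr mat_gam \<star> (gr 1 + gr mat_eps) \<star> gr mat_del)))
       in qlinear_map (FSh_pol w) (LSh2 w) \<phi> \<and>
          bij_betw \<phi> (FSh_pol w) (LSh2 w) \<and>
          qlinear_map (LSh2 w) (FSh_pol w) \<psi> \<and>
          (\<forall>Q\<in>FSh_pol w. \<psi> (\<phi> Q) = Q) \<and>
          (\<forall>P\<in>LSh2 w. \<phi> (\<psi> P) = P)))"
proof -
  have "bij_betw phi (FSh_pol w) (LSh2 w)" if "odd w" for w
    by (rule bij_betw_byWitness[where f' = psi])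
      (use that in \<open>auto simp: psi_phi phi_psi phi_mem psi_mem\<close>)
  then show ?thesis
    unfolding Let_def gr_act_phi gr_act_psi
    unfolding phi_def[symmetric] psi_def[symmetric]
    by (auto simp: W_od_subset_LSh2[THEN subsetD] qlinear_map_def subspace_LSh2 subspace_FSh_pol
        phi_mem psi_mem psi_phi phi_psi phi_add phi_qscale psi_add psi_qscale)
qed

end
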